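(* Let $q$ be a complex number with $|q|<1$, and let $$Y(q):=\sum_{n=1}^\infty\sum_{m=1}^\infty\frac{(-1)^m q^{2nm+m}}{(1-q^{2m-1})(1+q^n)}.$$ Then $$Y(q)=-q\,\frac{(q^4;q^4)_\infty^4}{(q^2;q^2)_\infty^2}\sum_{k=1}^{\infty}\frac{q^{2k}}{1+q^{2k}}.$$
   Context: For complex $a$ and $|q|<1$, $(a;q)_\infty:=\prod_{j=0}^{\infty}(1-aq^j)$; thus $(q^4;q^4)_\infty=\prod_{j\ge1}(1-q^{4j})$ and $(q^2;q^2)_\infty=\prod_{j\ge1}(1-q^{2j})$. *)

theory Defs
  imports "HOL-Analysis.Analysis"
begin

definition qpoch_inf :: "complex \<Rightarrow> complex \<Rightarrow> complex" where
  "qpoch_inf a q = (\<Prod>j. 1 - a * q ^ j)"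

definition Y_term :: "complex \<Rightarrow> nat \<Rightarrow> nat \<Rightarrow> complex" where
  "Y_term q n m =
     (-1) ^ m * q ^ (2 * n * m + m) / ((1 - q ^ (2 * m - 1)) * (1 + q ^ n))"

(* Both indices range from 1, hence the shifts by Suc;
   in particular the exponent 2 * m - 1 is never truncated. *)
definition Y :: "complex \<Rightarrow> complex" where
  "Y q = (\<Sum>n. \<Sum>m. Y_term q (Suc n) (Suc m))"

end

theory Submission
  imports Defs
begin

text \<open>
  Put $p = q^2$ and let $\varphi(z) = \sum_j \alpha_j z^j$ with
  $\alpha_j = (q;p)_j/(p;p)_j$. By the $q$-binomial theorem
  $\varphi(z) = (qz;p)_\infty/(z;p)_\infty$, so its logarithmic derivative is a Lambert series:
  $$\sum_j j \alpha_j z^j = \varphi(z)\,\Lambda(z), \qquad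
    \Lambda(z) = \sum_{n\ge1} \frac{1-q^n}{1-p^n} z^n = \sum_{n\ge1} \frac{z^n}{1+q^n}.$$

  The inner sum over $n$ in $Y(q)$ is a value of $\Lambda$: summing over $n$ first and shifting
  $m$ by one gives
  $$Y(q) = -q \sum_{m\ge0} \frac{(-q)^m}{1-q p^m}\,\Lambda(p^{m+1}).$$
  The factor $1/(1-qp^m)$ is exactly what is needed to get rid of $\Lambda$ again, because
  $\alpha_m \varphi(p^{m+1}) = B/(1-qp^m)$ with $B = (q;p)_\infty/(p;p)_\infty$. Hence
  $$Y(q) = -\frac{q}{B} \sum_{m,j} (-q)^m \alpha_m \, j \alpha_j \, p^{(m+1)j}
         = -\frac{q}{B} \sum_j j \alpha_j \, p^j \varphi(-q p^j).$$
  Now $\alpha_j \varphi(-qp^j)$ is, up to the constant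
  $R = (-q^2;p)_\infty/(-q;p)_\infty$, the coefficient $\alpha_j$ with $q$ replaced by $q^2$,
  since $(q;p)_j(-q;p)_j = (q^2;q^4)_j$ and $(p;p)_j(-p;p)_j = (q^4;q^4)_j$. So what remains is the
  logarithmic derivative identity a second time, for the base $q^4$ and at the point $z = q^2$.
  There the Lambert series is $\sum_k q^{2k}/(1+q^{2k})$, and the accumulated infinite products
  simplify to the stated quotient.

  The two lemmas that carry the argument are \<open>qbinom_theorem\<close> and \<open>qbinom_theta_eq\<close>. Both
  rest on the functional equation $(1-z)\varphi(z) = (1-qz)\varphi(pz)$ and on the fact that
  iterating $z \mapsto pz$ leads to the origin. They are stated for a
  parameter $a$ and a base $p$, since they are applied to $(a,p) = (q,q^2)$ and to $(q^2,q^4)$.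
\<close>

section \<open>Interchange of sums and dilations\<close>

lemma suminf_swap:
  fixes f :: "nat \<Rightarrow> nat \<Rightarrow> complex" and u v :: "nat \<Rightarrow> real"
  assumes bound: "\<And>i j. norm (f i j) \<le> u i * v j"
    and u: "summable u" "\<And>i. 0 \<le> u i" and v: "summable v" "\<And>j. 0 \<le> v j"
  shows "(\<Sum>i. \<Sum>j. f i j) = (\<Sum>j. \<Sum>i. f i j)"
proof -
  have U: "u summable_on UNIV" and V: "v summable_on UNIV"
    using u v by (auto intro!: norm_summable_imp_summable_on)
  have "(\<lambda>ij. norm (case ij of (i, j) \<Rightarrow> u i * v j)) summable_on (UNIV \<times> UNIV)"
    unfolding Infinite_Sum.abs_summable_on_Sigma_iff prod.case
  proof (intro conjI ballI)
    have norm_eq: "norm (u i * v j) = u i * v j" for i j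
      using u v by simp
    show "(\<lambda>j. norm (u i * v j)) summable_on UNIV" for i
      unfolding norm_eq by (rule summable_on_cmult_right[OF V])
    have "norm (\<Sum>\<^sub>\<infinity>j. norm (u i * v j)) = u i * (\<Sum>\<^sub>\<infinity>j. v j)" for i
      unfolding norm_eq infsum_cmult_right' using u v by (simp add: infsum_nonneg)
    thus "(\<lambda>i. norm (\<Sum>\<^sub>\<infinity>j. norm (u i * v j))) summable_on UNIV"
      by (simp only: summable_on_cmult_left[OF U])
  qed
  hence "(\<lambda>ij. u (fst ij) * v (snd ij)) summable_on (UNIV \<times> UNIV)"
    using u v by (simp add: case_prod_unfold)
  hence abs: "(\<lambda>ij. norm (f (fst ij) (snd ij))) summable_on (UNIV \<times> UNIV)"
    by (rule summable_on_comparison_test) (use bound in auto)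
  have sm: "(\<lambda>(i, j). f i j) summable_on (UNIV \<times> UNIV)"
    using abs_summable_summable[OF abs] by (simp add: case_prod_unfold)
  hence sm': "(\<lambda>(j, i). f i j) summable_on (UNIV \<times> UNIV)"
    by (subst (asm) summable_on_swap) (simp add: case_prod_unfold)
  have to_suminf: "infsum g UNIV = suminf g" if "g summable_on UNIV" for g :: "nat \<Rightarrow> complex"
    using that by (metis has_sum_imp_sums has_sum_infsum sums_unique)
  have row: "f i summable_on UNIV" for i
    by (rule norm_summable_imp_summable_on,
        rule summable_comparison_test'[OF summable_mult[OF v(1), of "u i"], of 0])
      (simp add: bound)
  have column: "(\<lambda>i. f i j) summable_on UNIV" for j
    by (rule norm_summable_imp_summable_on,
        rule summable_comparison_test'[OF summable_mult2[OF u(1), of "v j"], of 0])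
      (simp add: bound)
  show ?thesis
    using infsum_swap_banach[OF sm] summable_on_Sigma_banach[OF sm] summable_on_Sigma_banach[OF sm']
    by (simp add: to_suminf row column)
qed

text \<open>
  Two functions with the same functional equation under $z \mapsto pz$ are compared by applying
  this to their difference: $p^n z \to 0$ carries the value at $z$ to the value at the origin.
\<close>

lemma dilation_invariant_imp_constant:
  fixes f :: "complex \<Rightarrow> complex"
  assumes p: "norm p < 1" and inv: "\<And>z. norm z < 1 \<Longrightarrow> f (p * z) = f z"
    and cont: "isCont f 0" and z: "norm z < 1"
  shows "f z = f 0"
proof -
  have "f (p ^ n * z) = f z" for n
  proof (induction n)
    case (Suc n)
    have "norm (p ^ n * z) \<le> 1 * norm z"
      unfolding norm_mult norm_power using p by (intro mult_right_mono power_le_one) auto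
    with inv[of "p ^ n * z"] Suc z show ?case by (simp add: mult.assoc)
  qed simp
  moreover have "(\<lambda>n. f (p ^ n * z)) \<longlonglongrightarrow> f 0"
  proof (rule isCont_tendsto_compose[OF cont])
    show "(\<lambda>n. p ^ n * z) \<longlonglongrightarrow> 0"
      using tendsto_mult_left_zero[OF LIMSEQ_power_zero[OF p]] by simp
  qed
  ultimately show ?thesis by (simp add: LIMSEQ_const_iff)
qed

lemma one_minus_nz: "norm (w :: complex) < 1 \<Longrightarrow> 1 - w \<noteq> 0"
  by auto

lemma norm_power_less_1: "norm (p :: complex) < 1 \<Longrightarrow> norm (p ^ Suc n) < 1"
  by (simp add: norm_power power_less_one_iff del: power_Suc)

lemma norm_mult_less_1: "norm (a :: complex) \<le> 1 \<Longrightarrow> norm z < 1 \<Longrightarrow> norm (a * z) < 1"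
  using mult_right_mono[of "norm a" 1 "norm z"] by (simp add: norm_mult)

section \<open>Infinite q-Pochhammer symbols\<close>

lemma qpoch_inf_convergent:
  assumes "norm p < 1"
  shows "convergent_prod (\<lambda>j. 1 - a * p ^ j :: complex)"
proof -
  have "summable (\<lambda>j. norm (a * p ^ j))"
    using assms by (auto simp: norm_mult norm_power intro!: summable_mult summable_geometric)
  hence "abs_convergent_prod (\<lambda>j. 1 - a * p ^ j)"
    by (intro summable_imp_abs_convergent_prod) simp
  thus ?thesis by (rule abs_convergent_prod_imp_convergent_prod)
qed

lemma qpoch_inf_LIMSEQ:
  assumes "norm p < 1"
  shows "(\<lambda>n. \<Prod>k<n. 1 - a * p ^ k) \<longlonglongrightarrow> qpoch_inf a p"
proof -
  have "(\<lambda>n. \<Prod>k<Suc n. 1 - a * p ^ k) \<longlonglongrightarrow> qpoch_inf a p"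
    using convergent_prod_LIMSEQ[OF qpoch_inf_convergent[OF assms, of a]]
    by (simp add: qpoch_inf_def lessThan_Suc_atMost)
  thus ?thesis by (rule LIMSEQ_imp_Suc)
qed

lemma qpoch_inf_nonzero:
  assumes "norm p < 1" "norm a < 1"
  shows "qpoch_inf a p \<noteq> 0"
  unfolding qpoch_inf_def
proof (rule prodinf_nonzero[OF qpoch_inf_convergent[OF assms(1)]])
  fix j
  have "norm (p ^ j * a) < 1"
    using assms by (intro norm_mult_less_1) (auto simp: norm_power power_le_one)
  thus "1 - a * p ^ j \<noteq> 0" by (intro one_minus_nz) (simp add: mult.commute)
qed

lemma qpoch_inf_split:
  assumes "norm p < 1"
  shows "qpoch_inf a p = (\<Prod>k<n. 1 - a * p ^ k) * qpoch_inf (a * p ^ n) p"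
proof (rule LIMSEQ_unique)
  show "(\<lambda>m. \<Prod>k<m + n. 1 - a * p ^ k) \<longlonglongrightarrow> qpoch_inf a p"
    using qpoch_inf_LIMSEQ[OF assms] by (rule LIMSEQ_ignore_initial_segment)
  have "(\<Prod>k<m + n. 1 - a * p ^ k) = (\<Prod>k<n. 1 - a * p ^ k) * (\<Prod>k<m. 1 - a * p ^ n * p ^ k)" for m
    by (induction m) (simp_all add: power_add mult_ac)
  thus "(\<lambda>m. \<Prod>k<m + n. 1 - a * p ^ k) \<longlonglongrightarrow> (\<Prod>k<n. 1 - a * p ^ k) * qpoch_inf (a * p ^ n) p"
    by (simp only:) (intro tendsto_intros qpoch_inf_LIMSEQ assms)
qed

lemma qpoch_inf_mult_uminus:
  assumes "norm p < 1"
  shows "qpoch_inf a p * qpoch_inf (- a) p = qpoch_inf (a ^ 2) (p ^ 2)"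
proof (rule LIMSEQ_unique)
  show "(\<lambda>n. \<Prod>k<n. 1 - a ^ 2 * (p ^ 2) ^ k) \<longlonglongrightarrow> qpoch_inf (a ^ 2) (p ^ 2)"
    using assms by (intro qpoch_inf_LIMSEQ) (simp add: norm_power power_less_one_iff)
  have "(\<Prod>k<n. 1 - a ^ 2 * (p ^ 2) ^ k) = (\<Prod>k<n. 1 - a * p ^ k) * (\<Prod>k<n. 1 - (- a) * p ^ k)" for n
    unfolding prod.distrib[symmetric]
    by (intro prod.cong) (simp_all add: power2_eq_square power_mult_distrib algebra_simps)
  thus "(\<lambda>n. \<Prod>k<n. 1 - a ^ 2 * (p ^ 2) ^ k) \<longlonglongrightarrow> qpoch_inf a p * qpoch_inf (- a) p"
    by (simp only:) (intro tendsto_intros qpoch_inf_LIMSEQ assms)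
qed

lemma qpoch_inf_even_odd:
  assumes "norm p < 1"
  shows "qpoch_inf a (p ^ 2) * qpoch_inf (a * p) (p ^ 2) = qpoch_inf a p"
proof (rule LIMSEQ_unique)
  have p2: "norm (p ^ 2) < 1"
    using assms by (simp add: norm_power power_less_one_iff)
  show "(\<lambda>n. \<Prod>k<2 * n. 1 - a * p ^ k) \<longlonglongrightarrow> qpoch_inf a p"
    using filterlim_compose[OF qpoch_inf_LIMSEQ[OF assms], of "\<lambda>n. 2 * n" sequentially]
    by (simp add: filterlim_at_top_mult_tendsto_pos mult_nat_left_at_top)
  have "(\<Prod>k<2 * n. 1 - a * p ^ k)
      = (\<Prod>k<n. 1 - a * (p ^ 2) ^ k) * (\<Prod>k<n. 1 - a * p * (p ^ 2) ^ k)" for n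
    by (induction n) (simp_all add: power_mult[symmetric] mult_ac)
  thus "(\<lambda>n. \<Prod>k<2 * n. 1 - a * p ^ k) \<longlonglongrightarrow> qpoch_inf a (p ^ 2) * qpoch_inf (a * p) (p ^ 2)"
    by (simp only:) (intro tendsto_intros qpoch_inf_LIMSEQ p2)
qed

section \<open>The q-binomial theorem and its logarithmic derivative\<close>

definition qbinom_coeff :: "complex \<Rightarrow> complex \<Rightarrow> nat \<Rightarrow> complex" where
  "qbinom_coeff a p j = (\<Prod>k<j. (1 - a * p ^ k) / (1 - p ^ Suc k))"

definition qbinom_series :: "complex \<Rightarrow> complex \<Rightarrow> complex \<Rightarrow> complex" where
  "qbinom_series a p z = (\<Sum>j. qbinom_coeff a p j * z ^ j)"

text \<open>
  The image of the series under $z\,\frac{d}{dz}$, taken coefficientwise, so that no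
  differentiation is involved below.
\<close>

definition qbinom_theta :: "complex \<Rightarrow> complex \<Rightarrow> complex \<Rightarrow> complex" where
  "qbinom_theta a p z = (\<Sum>j. of_nat j * qbinom_coeff a p j * z ^ j)"

text \<open>
  The logarithmic derivative $z\varphi'(z)/\varphi(z)$ of
  $\varphi(z) = (az;p)_\infty/(z;p)_\infty$ as a power series. The term for $n = 0$ is
  $0/0 = 0$ and so contributes nothing.
\<close>

definition lambert :: "complex \<Rightarrow> complex \<Rightarrow> complex \<Rightarrow> complex" where
  "lambert a p z = (\<Sum>n. (1 - a ^ n) / (1 - p ^ n) * z ^ n)"

lemma qbinom_coeff_rec:
  assumes "norm p < 1"
  shows "qbinom_coeff a p (Suc j) * (1 - p ^ Suc j) = qbinom_coeff a p j * (1 - a * p ^ j)"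
  using one_minus_nz[OF norm_power_less_1[OF assms, of j]]
  by (simp add: qbinom_coeff_def del: power_Suc)

lemma summable_norm_qbinom_theta:
  assumes p: "norm p < 1" and z: "norm z < 1"
  shows "summable (\<lambda>j. norm (of_nat j * qbinom_coeff a p j * z ^ j))"
proof -
  \<comment> \<open>the quotient of consecutive terms, which tends to \<open>z\<close>; it is meaningful for \<open>j > 0\<close> only\<close>
  define r where "r j = of_nat (Suc j) / of_nat j * ((1 - a * p ^ j) / (1 - p ^ Suc j)) * z" for j
  have lims: "(\<lambda>j. of_nat (Suc j) / of_nat j :: complex) \<longlonglongrightarrow> 1"
    "(\<lambda>j. p ^ j) \<longlonglongrightarrow> 0" "(\<lambda>j. p ^ Suc j) \<longlonglongrightarrow> 0"
    using LIMSEQ_power_zero[OF p] LIMSEQ_Suc LIMSEQ_Suc_n_over_n by blast+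
  have "(\<lambda>j. norm (r j)) \<longlonglongrightarrow> norm (1 * ((1 - a * 0) / (1 - 0)) * z)"
    unfolding r_def
    by (intro tendsto_norm tendsto_mult tendsto_divide tendsto_diff tendsto_const lims) simp
  moreover obtain c where c: "norm z < c" "c < 1"
    using dense z by blast
  ultimately have "eventually (\<lambda>j. norm (r j) < c) sequentially"
    by (intro order_tendstoD) auto
  then obtain N where N: "norm (r j) < c" if "j \<ge> N" for j
    by (auto simp: eventually_sequentially)
  show ?thesis
  proof (rule summable_ratio_test[OF c(2)])
    fix j assume j: "Suc N \<le> j"
    have "of_nat (Suc j) * qbinom_coeff a p (Suc j) * z ^ Suc j
        = r j * (of_nat j * qbinom_coeff a p j * z ^ j)"
      using j by (simp add: r_def qbinom_coeff_def)
    hence "norm (of_nat (Suc j) * qbinom_coeff a p (Suc j) * z ^ Suc j)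
        = norm (r j) * norm (of_nat j * qbinom_coeff a p j * z ^ j)"
      by (simp only: norm_mult)
    thus "norm (norm (of_nat (Suc j) * qbinom_coeff a p (Suc j) * z ^ Suc j))
        \<le> c * norm (norm (of_nat j * qbinom_coeff a p j * z ^ j))"
      using mult_right_mono[OF less_imp_le[OF N[of j]]] j by simp
  qed
qed

lemma summable_norm_qbinom_series:
  assumes "norm p < 1" "norm z < 1"
  shows "summable (\<lambda>j. norm (qbinom_coeff a p j * z ^ j))"
proof (rule summable_comparison_test'[OF summable_norm_qbinom_theta[OF assms, of a], of 1])
  fix j :: nat assume "1 \<le> j"
  thus "norm (norm (qbinom_coeff a p j * z ^ j)) \<le> norm (of_nat j * qbinom_coeff a p j * z ^ j)"
    using mult_right_mono[of 1 "real j" "norm (qbinom_coeff a p j * z ^ j)"]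
    by (simp add: norm_mult mult.assoc)
qed

lemmas summable_qbinom_theta = summable_norm_qbinom_theta[THEN summable_norm_cancel]
lemmas summable_qbinom_series = summable_norm_qbinom_series[THEN summable_norm_cancel]

lemma qbinom_series_0: "qbinom_series a p 0 = 1"
  by (simp add: qbinom_series_def qbinom_coeff_def)

lemma qbinom_theta_0: "qbinom_theta a p 0 = 0"
  using powser_zero[of "\<lambda>j. of_nat j * qbinom_coeff a p j"] by (simp add: qbinom_theta_def)

lemma lambert_0: "lambert a p 0 = 0"
  using powser_zero[of "\<lambda>n. (1 - a ^ n) / (1 - p ^ n)"] by (simp add: lambert_def)

text \<open>
  Comparing coefficients, this is the recurrence of the $q$-binomial coefficients: the difference
  $\varphi(z) - \varphi(pz)$ multiplies the $j$-th coefficient by $1 - p^j$.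
\<close>

lemma qbinom_series_dilation:
  assumes p: "norm p < 1" and z: "norm z < 1"
  shows "(1 - z) * qbinom_series a p z = (1 - a * z) * qbinom_series a p (p * z)"
proof -
  let ?c = "qbinom_coeff a p"
  have pz: "norm (p * z) < 1" using p z by (intro norm_mult_less_1) auto
  have S: "(\<lambda>j. ?c j * w ^ j) sums qbinom_series a p w" if "norm w < 1" for w
    using summable_qbinom_series[OF p that] by (simp add: qbinom_series_def summable_sums)
  have "(\<lambda>j. ?c j * z ^ j - ?c j * (p * z) ^ j) sums (qbinom_series a p z - qbinom_series a p (p * z))"
    by (intro sums_diff S z pz)
  hence "(\<lambda>j. ?c (Suc j) * z ^ Suc j - ?c (Suc j) * (p * z) ^ Suc j)
      sums (qbinom_series a p z - qbinom_series a p (p * z))"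
    by (subst sums_Suc_iff) simp
  moreover have "?c (Suc j) * z ^ Suc j - ?c (Suc j) * (p * z) ^ Suc j
      = z * (?c j * z ^ j) - a * z * (?c j * (p * z) ^ j)" for j
  proof -
    have "?c (Suc j) * z ^ Suc j - ?c (Suc j) * (p * z) ^ Suc j = (?c (Suc j) * (1 - p ^ Suc j)) * z ^ Suc j"
      by (simp only: power_mult_distrib algebra_simps mult_1_left)
    thus ?thesis unfolding qbinom_coeff_rec[OF p] by (simp add: power_mult_distrib algebra_simps)
  qed
  moreover have "(\<lambda>j. z * (?c j * z ^ j) - a * z * (?c j * (p * z) ^ j))
      sums (z * qbinom_series a p z - a * z * qbinom_series a p (p * z))"
    by (intro sums_diff sums_mult S z pz)
  ultimately have "qbinom_series a p z - qbinom_series a p (p * z)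
      = z * qbinom_series a p z - a * z * qbinom_series a p (p * z)"
    by (metis (no_types, lifting) sums_unique2 ext)
  thus ?thesis by (simp add: algebra_simps)
qed

text \<open>
  Formally the previous equation after applying $z\,\frac{d}{dz}$; it is obtained in the same
  way from the recurrence multiplied by $j$.
\<close>

lemma qbinom_theta_dilation:
  assumes p: "norm p < 1" and z: "norm z < 1"
  shows "(1 - z) * qbinom_theta a p z - z * qbinom_series a p z
       = (1 - a * z) * qbinom_theta a p (p * z) - a * z * qbinom_series a p (p * z)"
proof -
  let ?c = "qbinom_coeff a p"
  have pz: "norm (p * z) < 1" using p z by (intro norm_mult_less_1) auto
  have S: "(\<lambda>j. ?c j * w ^ j) sums qbinom_series a p w" if "norm w < 1" for w
    using summable_qbinom_series[OF p that] by (simp add: qbinom_series_def summable_sums)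
  have T: "(\<lambda>j. of_nat j * ?c j * w ^ j) sums qbinom_theta a p w" if "norm w < 1" for w
    using summable_qbinom_theta[OF p that] by (simp add: qbinom_theta_def summable_sums)
  have "(\<lambda>j. of_nat j * ?c j * z ^ j - of_nat j * ?c j * (p * z) ^ j)
      sums (qbinom_theta a p z - qbinom_theta a p (p * z))"
    by (intro sums_diff T z pz)
  hence "(\<lambda>j. of_nat (Suc j) * ?c (Suc j) * z ^ Suc j - of_nat (Suc j) * ?c (Suc j) * (p * z) ^ Suc j)
      sums (qbinom_theta a p z - qbinom_theta a p (p * z))"
    by (subst sums_Suc_iff) simp
  moreover have "of_nat (Suc j) * ?c (Suc j) * z ^ Suc j - of_nat (Suc j) * ?c (Suc j) * (p * z) ^ Suc j
      = z * (of_nat j * ?c j * z ^ j + ?c j * z ^ j)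
        - a * z * (of_nat j * ?c j * (p * z) ^ j + ?c j * (p * z) ^ j)" for j
  proof -
    have "of_nat (Suc j) * ?c (Suc j) * z ^ Suc j - of_nat (Suc j) * ?c (Suc j) * (p * z) ^ Suc j
        = of_nat (Suc j) * (?c (Suc j) * (1 - p ^ Suc j)) * z ^ Suc j"
      by (simp only: power_mult_distrib algebra_simps mult_1_left)
    thus ?thesis unfolding qbinom_coeff_rec[OF p] by (simp add: power_mult_distrib algebra_simps)
  qed
  moreover have "(\<lambda>j. z * (of_nat j * ?c j * z ^ j + ?c j * z ^ j)
        - a * z * (of_nat j * ?c j * (p * z) ^ j + ?c j * (p * z) ^ j))
      sums (z * (qbinom_theta a p z + qbinom_series a p z)
        - a * z * (qbinom_theta a p (p * z) + qbinom_series a p (p * z)))"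
    by (intro sums_diff sums_add sums_mult S T z pz)
  ultimately have "qbinom_theta a p z - qbinom_theta a p (p * z)
      = z * (qbinom_theta a p z + qbinom_series a p z)
        - a * z * (qbinom_theta a p (p * z) + qbinom_series a p (p * z))"
    by (metis (no_types, lifting) sums_unique2 ext)
  thus ?thesis by (simp add: algebra_simps)
qed

lemma isCont_qbinom_series: "norm p < 1 \<Longrightarrow> isCont (qbinom_series a p) 0"
  unfolding qbinom_series_def
  by (rule isCont_powser[of _ "1/2"]) (auto intro: summable_qbinom_series)

lemma isCont_qbinom_theta: "norm p < 1 \<Longrightarrow> isCont (qbinom_theta a p) 0"
  unfolding qbinom_theta_def
  by (rule isCont_powser[of _ "1/2"]) (auto intro: summable_qbinom_theta)

text \<open>
  After $n$ steps the functional equation expresses the series through its value at $p^n z$, which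
  tends to the constant coefficient $1$, while the factors build up the two infinite products.
\<close>

lemma qbinom_theorem:
  assumes p: "norm p < 1" and z: "norm z < 1"
  shows "qpoch_inf z p * qbinom_series a p z = qpoch_inf (a * z) p"
proof (rule LIMSEQ_unique)
  have tail: "norm (p ^ n * z) < 1" for n
    using p z by (intro norm_mult_less_1) (auto simp: norm_power power_le_one)
  have "(\<Prod>k<n. 1 - z * p ^ k) * qbinom_series a p z
      = (\<Prod>k<n. 1 - a * z * p ^ k) * qbinom_series a p (p ^ n * z)" for n
  proof (induction n)
    case (Suc n)
    have "(\<Prod>k<Suc n. 1 - z * p ^ k) * qbinom_series a p z
        = (1 - z * p ^ n) * ((\<Prod>k<n. 1 - z * p ^ k) * qbinom_series a p z)"
      by simp
    also have "\<dots> = (\<Prod>k<n. 1 - a * z * p ^ k) * ((1 - p ^ n * z) * qbinom_series a p (p ^ n * z))"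
      unfolding Suc.IH by (simp add: mult.commute[of z])
    also have "\<dots> = (\<Prod>k<Suc n. 1 - a * z * p ^ k) * qbinom_series a p (p ^ Suc n * z)"
      unfolding qbinom_series_dilation[OF p tail] by (simp add: mult_ac)
    finally show ?case .
  qed simp
  moreover have "(\<lambda>n. qbinom_series a p (p ^ n * z)) \<longlonglongrightarrow> 1"
  proof -
    have "(\<lambda>n. p ^ n * z) \<longlonglongrightarrow> 0"
      using tendsto_mult_left_zero[OF LIMSEQ_power_zero[OF p]] by simp
    from isCont_tendsto_compose[OF isCont_qbinom_series[OF p] this] show ?thesis
      by (simp add: qbinom_series_0)
  qed
  hence "(\<lambda>n. (\<Prod>k<n. 1 - a * z * p ^ k) * qbinom_series a p (p ^ n * z))
      \<longlonglongrightarrow> qpoch_inf (a * z) p * 1"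
    by (intro tendsto_intros qpoch_inf_LIMSEQ p)
  ultimately show "(\<lambda>n. (\<Prod>k<n. 1 - z * p ^ k) * qbinom_series a p z) \<longlonglongrightarrow> qpoch_inf (a * z) p"
    by simp
  show "(\<lambda>n. (\<Prod>k<n. 1 - z * p ^ k) * qbinom_series a p z)
      \<longlonglongrightarrow> qpoch_inf z p * qbinom_series a p z"
    by (intro tendsto_intros qpoch_inf_LIMSEQ p)
qed

lemma qbinom_series_nonzero:
  assumes "norm p < 1" "norm a \<le> 1" "norm z < 1"
  shows "qbinom_series a p z \<noteq> 0"
  using qbinom_theorem[OF assms(1,3), of a] qpoch_inf_nonzero[OF assms(1) norm_mult_less_1[OF assms(2,3)]]
  by auto

lemma summable_lambert:
  fixes a p z :: complex
  assumes p: "norm p < 1" and a: "norm a \<le> 1" and z: "norm z < 1"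
  shows "summable (\<lambda>n. norm ((1 - a ^ n) / (1 - p ^ n) * z ^ n))"
proof (rule summable_comparison_test'[of "\<lambda>n. 2 / (1 - norm p) * norm z ^ n" 1])
  show "summable (\<lambda>n. 2 / (1 - norm p) * norm z ^ n)"
    using z by (intro summable_mult summable_geometric) simp
  fix n :: nat assume n: "1 \<le> n"
  have "norm (1 - a ^ n :: complex) \<le> norm (1 :: complex) + norm (a ^ n :: complex)" by (rule norm_triangle_ineq4)
  also have "\<dots> \<le> 2" using a by (simp add: norm_power power_le_one)
  finally have num: "norm (1 - a ^ n) \<le> 2" .
  have "norm p ^ n \<le> norm p" using p n power_decreasing[of 1 n "norm p"] by simp
  moreover have "1 - norm (p ^ n) \<le> norm (1 - p ^ n)"
    using norm_triangle_ineq2[of 1 "p ^ n"] by simp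
  ultimately have "1 - norm p \<le> norm (1 - p ^ n)" by (simp add: norm_power)
  hence "norm (1 - a ^ n) / norm (1 - p ^ n) \<le> 2 / (1 - norm p)"
    using num p by (intro frac_le) auto
  thus "norm (norm ((1 - a ^ n) / (1 - p ^ n) * z ^ n)) \<le> 2 / (1 - norm p) * norm z ^ n"
    unfolding norm_mult norm_divide norm_power real_norm_def abs_norm_cancel
    using z by (simp only: abs_of_nonneg divide_nonneg_nonneg mult_nonneg_nonneg norm_ge_zero
        zero_le_power mult_right_mono)
qed

text \<open>
  Taking the difference cancels the denominators $1 - p^n$ and leaves two geometric series. The
  right-hand side is the logarithmic derivative of $(1-az)/(1-z)$, the factor in the functional equation of
  the $q$-binomial series.
\<close>

lemma lambert_dilation:
  assumes p: "norm p < 1" and a: "norm a \<le> 1" and z: "norm z < 1"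
  shows "lambert a p z - lambert a p (p * z) = z / (1 - z) - a * z / (1 - a * z)"
proof -
  have pz: "norm (p * z) < 1" using p z by (intro norm_mult_less_1) auto
  have az: "norm (a * z) < 1" using a z by (rule norm_mult_less_1)
  have L: "(\<lambda>n. (1 - a ^ n) / (1 - p ^ n) * w ^ n) sums lambert a p w" if "norm w < 1" for w
    using summable_lambert[OF p a that, THEN summable_norm_cancel]
    by (simp add: lambert_def summable_sums)
  have "(\<lambda>n. (1 - a ^ n) / (1 - p ^ n) * z ^ n - (1 - a ^ n) / (1 - p ^ n) * (p * z) ^ n)
      sums (lambert a p z - lambert a p (p * z))"
    by (intro sums_diff L z pz)
  moreover have "(1 - a ^ n) / (1 - p ^ n) * z ^ n - (1 - a ^ n) / (1 - p ^ n) * (p * z) ^ n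
      = z ^ n - (a * z) ^ n" for n
  proof (cases n)
    case (Suc k)
    have nz: "1 - p ^ n \<noteq> 0"
      using one_minus_nz[OF norm_power_less_1[OF p, of k]] by (simp only: Suc not_False_eq_True)
    have "(1 - a ^ n) / (1 - p ^ n) * z ^ n - (1 - a ^ n) / (1 - p ^ n) * (p * z) ^ n
       = (1 - a ^ n) / (1 - p ^ n) * (1 - p ^ n) * z ^ n"
      by (simp only: power_mult_distrib algebra_simps mult_1_left)
    also have "\<dots> = (1 - a ^ n) * z ^ n" using nz by simp
    finally show ?thesis by (simp only: power_mult_distrib left_diff_distrib mult_1_left)
  qed simp
  moreover have "(\<lambda>n. z ^ n - (a * z) ^ n) sums (1 / (1 - z) - 1 / (1 - a * z))"
    by (intro sums_diff geometric_sums z az)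
  ultimately have "lambert a p z - lambert a p (p * z) = 1 / (1 - z) - 1 / (1 - a * z)"
    by (metis (no_types, lifting) sums_unique2 ext)
  moreover have "1 / (1 - w) = w / (1 - w) + 1" if "norm w < 1" for w :: complex
    using one_minus_nz[OF that] by (simp add: field_simps)
  ultimately show ?thesis using z az by simp
qed

lemma isCont_lambert: "norm p < 1 \<Longrightarrow> norm a \<le> 1 \<Longrightarrow> isCont (lambert a p) 0"
  unfolding lambert_def
  by (rule isCont_powser[of _ "1/2"], rule summable_lambert[THEN summable_norm_cancel]) simp_all

text \<open>
  The identity $z\varphi' = \varphi\Lambda$. By the dilation rules $z\varphi'/\varphi$ and
  $\Lambda$ change by the same amount under $z \mapsto pz$, so their difference is constant, and
  it vanishes at the origin.
\<close>

lemma qbinom_theta_eq: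
  assumes p: "norm p < 1" and a: "norm a \<le> 1" and z: "norm z < 1"
  shows "qbinom_theta a p z = qbinom_series a p z * lambert a p z"
proof -
  define f where "f w = qbinom_theta a p w / qbinom_series a p w - lambert a p w" for w
  have "f z = f 0"
  proof (rule dilation_invariant_imp_constant[OF p _ _ z])
    show "isCont f 0"
      unfolding f_def
      by (intro continuous_intros isCont_qbinom_theta isCont_qbinom_series isCont_lambert p a)
        (simp add: qbinom_series_0)
    fix w :: complex assume w: "norm w < 1"
    have pw: "norm (p * w) < 1" using p w by (intro norm_mult_less_1) auto
    have aw: "norm (a * w) < 1" using a w by (rule norm_mult_less_1)
    let ?F = "qbinom_series a p w" and ?G = "qbinom_series a p (p * w)"
    let ?T = "qbinom_theta a p w" and ?U = "qbinom_theta a p (p * w)"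
    note nz = one_minus_nz[OF w] one_minus_nz[OF aw] qbinom_series_nonzero[OF p a w]
      qbinom_series_nonzero[OF p a pw]
    have F: "(1 - w) * ?F = (1 - a * w) * ?G" by (rule qbinom_series_dilation[OF p w])
    have "?T / ?F - w / (1 - w) = ((1 - w) * ?T - w * ?F) / ((1 - w) * ?F)"
      using nz by (simp add: diff_divide_distrib)
    also have "\<dots> = ((1 - a * w) * ?U - a * w * ?G) / ((1 - a * w) * ?G)"
      by (simp only: F qbinom_theta_dilation[OF p w])
    also have "\<dots> = ?U / ?G - a * w / (1 - a * w)"
      using nz by (simp add: diff_divide_distrib)
    finally show "f (p * w) = f w"
      using lambert_dilation[OF p a w] by (simp only: f_def diff_eq_eq) simp
  qed
  thus ?thesis
    using qbinom_series_nonzero[OF p a z]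
    by (simp add: f_def qbinom_theta_0 lambert_0 field_simps)
qed

lemma qbinom_coeff_altdef:
  "qbinom_coeff a p j = (\<Prod>k<j. 1 - a * p ^ k) / (\<Prod>k<j. 1 - p * p ^ k)"
  by (simp add: qbinom_coeff_def prod_dividef)

section \<open>Absorbing q-binomial coefficients into values of the series\<close>

text \<open>
  At the point $p^{i+1}$ the product $(z;p)_\infty$ is a tail of $(p;p)_\infty$ whose missing part
  is the denominator of the $i$-th coefficient. In the numerator the same completion of
  $(a;p)_\infty$ misses only the factor with index $i$. This turns the factors $1/(1-qp^m)$ in
  $Y(q)$ into values of the series.
\<close>

lemma qbinom_coeff_times_series:
  assumes p: "norm p < 1" and a: "norm a < 1"
  shows "qbinom_coeff a p i * qbinom_series a p (p ^ Suc i)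
       = qpoch_inf a p / qpoch_inf p p / (1 - a * p ^ i)"
proof -
  note z = norm_power_less_1[OF p, of i]
  have ap: "norm (p ^ i * a) < 1"
    using p a by (intro norm_mult_less_1) (auto simp: norm_power power_le_one)
  have a_split: "qpoch_inf a p
      = (\<Prod>k<i. 1 - a * p ^ k) * ((1 - a * p ^ i) * qpoch_inf (a * p ^ Suc i) p)"
    using qpoch_inf_split[OF p, of a "Suc i"] by (simp add: mult_ac)
  have p_split: "qpoch_inf p p = (\<Prod>k<i. 1 - p * p ^ k) * qpoch_inf (p ^ Suc i) p"
    using qpoch_inf_split[OF p, of p i] by simp
  have nz: "qpoch_inf p p \<noteq> 0" "1 - a * p ^ i \<noteq> 0"
    using qpoch_inf_nonzero[OF p p] one_minus_nz[OF ap] by (simp_all add: mult.commute)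
  from qbinom_theorem[OF p z, of a]
  have "qbinom_series a p (p ^ Suc i) = qpoch_inf (a * p ^ Suc i) p / qpoch_inf (p ^ Suc i) p"
    using qpoch_inf_nonzero[OF p z] by (simp add: field_simps)
  thus ?thesis
    using nz unfolding qbinom_coeff_altdef a_split p_split by simp
qed

text \<open>
  The value of the series at $-qp^j$ is a constant times $(-q;p)_j/(-p;p)_j$, and
  $(1-x)(1+x) = 1-x^2$ merges this factorwise with $(q;p)_j/(p;p)_j$. The result is again a
  $q$-binomial coefficient, with $q$ replaced by its square.
\<close>

lemma qbinom_coeff_base_square:
  assumes q: "norm q < 1"
  shows "qbinom_coeff q (q ^ 2) j * qbinom_series q (q ^ 2) (- q * (q ^ 2) ^ j)
       = qpoch_inf (- (q ^ 2)) (q ^ 2) / qpoch_inf (- q) (q ^ 2) * qbinom_coeff (q ^ 2) (q ^ 4) j"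
proof -
  let ?p = "q ^ 2"
  have p: "norm ?p < 1" using q by (simp add: norm_power power_less_one_iff)
  have z: "norm (- q * ?p ^ j) < 1"
    using norm_mult_less_1[of "?p ^ j" "-q"] p q
    by (simp add: norm_power power_le_one mult.commute)
  let ?A = "\<Prod>k<j. 1 - (- q) * ?p ^ k" and ?B = "\<Prod>k<j. 1 - (- ?p) * ?p ^ k"
  let ?C = "\<Prod>k<j. 1 - q * ?p ^ k" and ?D = "\<Prod>k<j. 1 - ?p * ?p ^ k"
  have A: "qpoch_inf (- q) ?p = ?A * qpoch_inf (- q * ?p ^ j) ?p"
    by (rule qpoch_inf_split[OF p])
  have B: "qpoch_inf (- ?p) ?p = ?B * qpoch_inf (q * (- q * ?p ^ j)) ?p"
    using qpoch_inf_split[OF p, of "- ?p" j] by (simp add: power2_eq_square mult_ac)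
  have nz: "qpoch_inf (- q) ?p \<noteq> 0" "qpoch_inf (- ?p) ?p \<noteq> 0"
    using q p by (simp_all add: qpoch_inf_nonzero)
  have series: "qbinom_series q ?p (- q * ?p ^ j)
      = qpoch_inf (q * (- q * ?p ^ j)) ?p / qpoch_inf (- q * ?p ^ j) ?p"
    using qbinom_theorem[OF p z, of q] qpoch_inf_nonzero[OF p z] by (simp add: field_simps)
  have q4: "(q ^ 4) ^ k = (?p ^ k) ^ 2" for k by (simp flip: power_mult)
  have CA: "?C * ?A = (\<Prod>k<j. 1 - ?p * (q ^ 4) ^ k)"
    unfolding prod.distrib[symmetric]
    by (intro prod.cong) (simp_all add: q4 eval_nat_numeral algebra_simps)
  have DB: "?D * ?B = (\<Prod>k<j. 1 - q ^ 4 * (q ^ 4) ^ k)"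
    unfolding prod.distrib[symmetric]
    by (intro prod.cong) (simp_all add: q4 eval_nat_numeral algebra_simps)
  have "qbinom_coeff ?p (q ^ 4) j = (?C * ?A) / (?D * ?B)"
    unfolding CA DB by (rule qbinom_coeff_altdef)
  moreover have "?A \<noteq> 0" "?B \<noteq> 0" "qpoch_inf (- q * ?p ^ j) ?p \<noteq> 0"
    using nz A B by auto
  ultimately show ?thesis
    unfolding series A B qbinom_coeff_altdef[of q ?p] by (simp add: mult_ac)
qed

section \<open>Evaluation of the double series\<close>

text \<open>
  Since $(1-q^n)/(1-q^{2n}) = 1/(1+q^n)$, summing over $n$ first produces a Lambert series in base
  $q^2$. The crude bound $|1 \pm q^k| \ge 1-|q|$ on the denominators makes the double series
  absolutely convergent.
\<close>

lemma Y_eq_lambert_sum: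
  assumes q: "norm q < 1"
  shows "Y q = (\<Sum>m. - q * ((- q) ^ m / (1 - q * (q ^ 2) ^ m) * lambert q (q ^ 2) ((q ^ 2) ^ Suc m)))"
proof -
  have p: "norm (q ^ 2) < 1" using q by (simp add: norm_power power_less_one_iff)
  let ?f = "\<lambda>n m. Y_term q (Suc n) (Suc m)"
  have bound: "norm (?f n m) \<le> (1 / (1 - norm q) * norm q ^ n) * (1 / (1 - norm q) * norm q ^ m)" for n m
  proof -
    have "1 - norm q \<le> 1 - norm q ^ Suc k" for k
      using q power_decreasing[of 1 "Suc k" "norm q"] by simp
    moreover have "1 - norm q ^ Suc k \<le> norm (1 - q ^ Suc k)"
      "1 - norm q ^ Suc k \<le> norm (1 + q ^ Suc k)" for k
      using norm_triangle_ineq2[of 1 "q ^ Suc k"] norm_triangle_ineq2[of 1 "- (q ^ Suc k)"]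
      by (simp_all add: norm_power norm_mult)
    ultimately have den: "1 - norm q \<le> norm (1 - q ^ Suc k)" "1 - norm q \<le> norm (1 + q ^ Suc k)" for k
      by (meson order_trans)+
    have "norm (?f n m) = norm q ^ (2 * Suc n * Suc m + Suc m)
        / (norm (1 - q ^ Suc (2 * m)) * norm (1 + q ^ Suc n))"
      by (simp add: Y_term_def norm_mult norm_divide norm_power del: power_Suc mult_Suc)
    also have "\<dots> \<le> norm q ^ (n + m) / ((1 - norm q) * (1 - norm q))"
      using q den by (intro frac_le mult_mono power_decreasing mult_pos_pos) auto
    finally show ?thesis by (simp add: power_add)
  qed
  have swap: "Y q = (\<Sum>m. \<Sum>n. ?f n m)"
    unfolding Y_def using q by (intro suminf_swap[OF bound] summable_mult summable_geometric) simp_all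
  have inner: "(\<Sum>n. ?f n m)
      = - q * ((- q) ^ m / (1 - q * (q ^ 2) ^ m) * lambert q (q ^ 2) ((q ^ 2) ^ Suc m))" for m
  proof -
    let ?l = "\<lambda>n. (1 - q ^ n) / (1 - (q ^ 2) ^ n) * ((q ^ 2) ^ Suc m) ^ n"
    have "?l sums lambert q (q ^ 2) ((q ^ 2) ^ Suc m)"
      unfolding lambert_def using q norm_power_less_1[OF p]
      by (intro summable_sums summable_lambert[OF p, THEN summable_norm_cancel]) auto
    hence "(\<lambda>n. ?l (Suc n)) sums lambert q (q ^ 2) ((q ^ 2) ^ Suc m)"
      by (subst sums_Suc_iff) simp
    hence "(\<lambda>n. - q * (- q) ^ m / (1 - q * (q ^ 2) ^ m) * ?l (Suc n))
        sums (- q * (- q) ^ m / (1 - q * (q ^ 2) ^ m) * lambert q (q ^ 2) ((q ^ 2) ^ Suc m))"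
      by (rule sums_mult)
    moreover have "- q * (- q) ^ m / (1 - q * (q ^ 2) ^ m) * ?l (Suc n) = ?f n m" for n
    proof -
      have nz: "1 - q ^ Suc n \<noteq> 0"
        using one_minus_nz[OF norm_power_less_1[OF q]] .
      have "1 - (q ^ 2) ^ Suc n = (1 - q ^ Suc n) * (1 + q ^ Suc n)"
        by (simp add: algebra_simps power2_eq_square power_mult_distrib)
      hence "(1 - q ^ Suc n) / (1 - (q ^ 2) ^ Suc n) = 1 / (1 + q ^ Suc n)"
        using nz by simp
      moreover have "- q * (- q) ^ m * ((q ^ 2) ^ Suc m) ^ Suc n
          = (-1) ^ Suc m * q ^ (2 * Suc n * Suc m + Suc m)"
      proof -
        have "((q ^ 2) ^ Suc m) ^ Suc n = q ^ (2 * Suc n * Suc m)"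
          by (simp only: power_mult[symmetric] mult_ac)
        moreover have "- q * (- q) ^ m = (-1) ^ Suc m * q ^ Suc m"
          by (metis power_Suc power_minus)
        ultimately show ?thesis by (simp only: power_add mult_ac)
      qed
      moreover have "q * (q ^ 2) ^ m = q ^ (2 * Suc m - 1)"
        by (simp add: power_mult)
      ultimately show ?thesis
        unfolding Y_term_def
        by (simp only: times_divide_eq_left times_divide_eq_right divide_divide_eq_left mult_ac
            mult_1_left mult_1_right)
    qed
    ultimately show ?thesis
      by (simp only: sums_iff) (simp only: mult.assoc times_divide_eq_right times_divide_eq_left)
  qed
  show ?thesis by (simp only: swap inner)
qed

text \<open>
  With $E = (q^4;q^4)_\infty$ and $F = (q^2;q^4)_\infty$, pairing $\pm$ products shows that the
  first two quotients multiply to $E/F$, and $(q^2;q^2)_\infty = FE$ by separating factors of even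
  and odd index. Both sides are then $E^2/F^2$.
\<close>

lemma qpoch_quotient:
  assumes q: "norm q < 1"
  shows "qpoch_inf (q ^ 2) (q ^ 2) / qpoch_inf q (q ^ 2)
       * (qpoch_inf (- (q ^ 2)) (q ^ 2) / qpoch_inf (- q) (q ^ 2))
       * (qpoch_inf (q ^ 4) (q ^ 4) / qpoch_inf (q ^ 2) (q ^ 4))
       = qpoch_inf (q ^ 4) (q ^ 4) ^ 4 / qpoch_inf (q ^ 2) (q ^ 2) ^ 2"
proof -
  have p: "norm (q ^ 2) < 1" using q by (simp add: norm_power power_less_one_iff)
  have p': "norm (q ^ 4) < 1" using q by (simp add: norm_power power_less_one_iff)
  have 1: "qpoch_inf (q ^ 2) (q ^ 2) * qpoch_inf (- (q ^ 2)) (q ^ 2) = qpoch_inf (q ^ 4) (q ^ 4)"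
    using qpoch_inf_mult_uminus[OF p, of "q ^ 2"] by simp
  have 2: "qpoch_inf q (q ^ 2) * qpoch_inf (- q) (q ^ 2) = qpoch_inf (q ^ 2) (q ^ 4)"
    using qpoch_inf_mult_uminus[OF p, of q] by simp
  have 3: "qpoch_inf (q ^ 2) (q ^ 4) * qpoch_inf (q ^ 4) (q ^ 4) = qpoch_inf (q ^ 2) (q ^ 2)"
    using qpoch_inf_even_odd[OF p, of "q ^ 2"] by (simp flip: power_add)
  have nz: "qpoch_inf (q ^ 4) (q ^ 4) \<noteq> 0" "qpoch_inf (q ^ 2) (q ^ 4) \<noteq> 0"
    using p p' by (simp_all add: qpoch_inf_nonzero)
  have "qpoch_inf (q ^ 2) (q ^ 2) / qpoch_inf q (q ^ 2)
       * (qpoch_inf (- (q ^ 2)) (q ^ 2) / qpoch_inf (- q) (q ^ 2))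
     = qpoch_inf (q ^ 4) (q ^ 4) / qpoch_inf (q ^ 2) (q ^ 4)"
    by (simp flip: 1 2)
  moreover have "E / F * (E / F) = E ^ 4 / (F * E) ^ 2" if "E \<noteq> 0" "F \<noteq> 0" for E F :: complex
    using that by (simp add: field_simps eval_nat_numeral)
  ultimately show ?thesis
    using nz by (simp only: 3[symmetric])
qed

lemma lambert_base_square:
  assumes q: "norm q < 1"
  shows "lambert (q ^ 2) (q ^ 4) (q ^ 2) = (\<Sum>k. q ^ (2 * Suc k) / (1 + q ^ (2 * Suc k)))"
proof -
  let ?l = "\<lambda>n. (1 - (q ^ 2) ^ n) / (1 - (q ^ 4) ^ n) * (q ^ 2) ^ n"
  have p: "norm (q ^ 2) < 1" using q by (simp add: norm_power power_less_one_iff)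
  have p': "norm (q ^ 4) < 1" using q by (simp add: norm_power power_less_one_iff)
  have "?l sums lambert (q ^ 2) (q ^ 4) (q ^ 2)"
    unfolding lambert_def using p p'
    by (intro summable_sums summable_lambert[THEN summable_norm_cancel]) auto
  hence "(\<lambda>n. ?l (Suc n)) sums lambert (q ^ 2) (q ^ 4) (q ^ 2)"
    by (subst sums_Suc_iff) simp
  moreover have "?l (Suc n) = q ^ (2 * Suc n) / (1 + q ^ (2 * Suc n))" for n
  proof -
    have nz: "1 - (q ^ 2) ^ Suc n \<noteq> 0"
      using one_minus_nz[OF norm_power_less_1[OF p]] .
    have "(q ^ 4) ^ Suc n = (q ^ 2) ^ Suc n * (q ^ 2) ^ Suc n"
      by (simp add: power_mult[symmetric] eval_nat_numeral algebra_simps)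
    hence "1 - (q ^ 4) ^ Suc n = (1 - (q ^ 2) ^ Suc n) * (1 + (q ^ 2) ^ Suc n)"
      by (simp only: algebra_simps mult_1_left)
    hence "?l (Suc n) = (q ^ 2) ^ Suc n / (1 + (q ^ 2) ^ Suc n)"
      using nz by simp
    thus ?thesis by (simp only: power_mult)
  qed
  ultimately show ?thesis by (simp only: sums_iff)
qed

theorem theorem1p2:
  fixes q :: complex
  assumes "norm q < 1"
  shows "Y q = - q * (qpoch_inf (q ^ 4) (q ^ 4) ^ 4 / qpoch_inf (q ^ 2) (q ^ 2) ^ 2) *
                 (\<Sum>k. q ^ (2 * Suc k) / (1 + q ^ (2 * Suc k)))"
proof -
  let ?p = "q ^ 2"
  have p: "norm ?p < 1" using assms by (simp add: norm_power power_less_one_iff)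
  have p': "norm (q ^ 4) < 1" using assms by (simp add: norm_power power_less_one_iff)
  let ?\<alpha> = "qbinom_coeff q ?p" and ?\<beta> = "qbinom_coeff ?p (q ^ 4)"
  define B where "B = qpoch_inf q ?p / qpoch_inf ?p ?p"
  define R where "R = qpoch_inf (- ?p) ?p / qpoch_inf (- q) ?p"
  \<comment> \<open>the terms of the double series: the sums over \<open>j\<close> are the summands of \<open>Y q\<close>, the sums
    over \<open>m\<close> are, up to a constant, the summands of \<open>qbinom_theta\<close> in base \<open>q ^ 4\<close>\<close>
  define f where "f m j = - q / B * (?\<alpha> m * (- q) ^ m * (of_nat j * ?\<alpha> j * (?p ^ Suc m) ^ j))" for m j
  have B: "B \<noteq> 0"
    using assms p by (simp add: B_def qpoch_inf_nonzero)
  have row: "- q * ((- q) ^ m / (1 - q * ?p ^ m) * lambert q ?p (?p ^ Suc m)) = (\<Sum>j. f m j)" for m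
  proof -
    note z = norm_power_less_1[OF p, of m]
    have "(\<lambda>j. of_nat j * ?\<alpha> j * (?p ^ Suc m) ^ j) sums qbinom_theta q ?p (?p ^ Suc m)"
      unfolding qbinom_theta_def by (intro summable_sums summable_qbinom_theta p z)
    hence "f m sums (- q / B * (?\<alpha> m * (- q) ^ m * qbinom_theta q ?p (?p ^ Suc m)))"
      unfolding f_def by (intro sums_mult)
    moreover have "?\<alpha> m * qbinom_series q ?p (?p ^ Suc m) = B / (1 - q * ?p ^ m)"
      unfolding B_def by (rule qbinom_coeff_times_series[OF p assms])
    hence "?\<alpha> m * qbinom_theta q ?p (?p ^ Suc m) = B / (1 - q * ?p ^ m) * lambert q ?p (?p ^ Suc m)"
      using assms by (simp only: qbinom_theta_eq[OF p _ z] less_imp_le mult.assoc[symmetric])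
    hence "- q / B * (?\<alpha> m * (- q) ^ m * qbinom_theta q ?p (?p ^ Suc m))
        = - q / B * ((- q) ^ m * (B / (1 - q * ?p ^ m) * lambert q ?p (?p ^ Suc m)))"
      by (simp only: mult.assoc mult.left_commute[of "?\<alpha> m"])
    ultimately show ?thesis
      using B by (simp add: sums_iff)
  qed
  have column: "(\<Sum>m. f m j) = - q / B * R * (of_nat j * ?\<beta> j * ?p ^ j)" for j
  proof -
    have z: "norm (- q * ?p ^ j) < 1"
      using norm_mult_less_1[of "?p ^ j" "-q"] p assms
      by (simp add: norm_power power_le_one mult.commute)
    have "(\<lambda>m. ?\<alpha> m * (- q * ?p ^ j) ^ m) sums qbinom_series q ?p (- q * ?p ^ j)"
      unfolding qbinom_series_def by (intro summable_sums summable_qbinom_series p z)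
    hence "(\<lambda>m. - q / B * (of_nat j * ?\<alpha> j * ?p ^ j) * (?\<alpha> m * (- q * ?p ^ j) ^ m))
        sums (- q / B * (of_nat j * ?\<alpha> j * ?p ^ j) * qbinom_series q ?p (- q * ?p ^ j))"
      by (rule sums_mult)
    moreover have "- q / B * (of_nat j * ?\<alpha> j * ?p ^ j) * (?\<alpha> m * (- q * ?p ^ j) ^ m) = f m j" for m
    proof -
      have "(?p ^ Suc m) ^ j = ?p ^ j * (?p ^ j) ^ m"
        by (simp add: power_mult_distrib power_mult[symmetric] mult_ac)
      thus ?thesis unfolding f_def by (simp only: power_mult_distrib mult_ac)
    qed
    ultimately have "(\<Sum>m. f m j)
        = - q / B * (of_nat j * ?p ^ j) * (?\<alpha> j * qbinom_series q ?p (- q * ?p ^ j))"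
      by (simp only: sums_iff mult_ac)
    also have "?\<alpha> j * qbinom_series q ?p (- q * ?p ^ j) = R * ?\<beta> j"
      unfolding R_def by (rule qbinom_coeff_base_square[OF assms])
    finally show ?thesis by (simp only: mult_ac)
  qed
  have bound: "norm (f m j) \<le> norm (?\<alpha> m * q ^ m) * (norm (q / B) * norm (of_nat j * ?\<alpha> j * ?p ^ j))" for m j
  proof -
    have "norm ((?p ^ Suc m) ^ j) \<le> norm (?p ^ j)"
      using p unfolding norm_power by (intro power_mono) (auto simp: mult_left_le power_le_one)
    hence "norm (?\<alpha> m * q ^ m) * (norm (q / B) * (norm (of_nat j * ?\<alpha> j) * norm ((?p ^ Suc m) ^ j)))
        \<le> norm (?\<alpha> m * q ^ m) * (norm (q / B) * (norm (of_nat j * ?\<alpha> j) * norm (?p ^ j)))"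
      by (intro mult_left_mono norm_ge_zero)
    thus ?thesis
      by (simp only: f_def norm_mult norm_divide norm_minus_cancel norm_power mult_ac)
  qed
  have "Y q = (\<Sum>m. \<Sum>j. f m j)"
    unfolding Y_eq_lambert_sum[OF assms] row ..
  also have "\<dots> = (\<Sum>j. \<Sum>m. f m j)"
    by (intro suminf_swap[OF bound] summable_mult summable_norm_qbinom_series
        summable_norm_qbinom_theta p assms mult_nonneg_nonneg norm_ge_zero)
  also have "\<dots> = - q / B * R * qbinom_theta ?p (q ^ 4) ?p"
    unfolding column qbinom_theta_def by (intro suminf_mult summable_qbinom_theta p p')
  also have "\<dots> = - q * (1 / B * R * qbinom_series ?p (q ^ 4) ?p) * lambert ?p (q ^ 4) ?p"
    using p by (simp add: qbinom_theta_eq[OF p' _ p])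
  also have "qbinom_series ?p (q ^ 4) ?p = qpoch_inf (q ^ 4) (q ^ 4) / qpoch_inf ?p (q ^ 4)"
    using qbinom_theorem[OF p' p, of ?p] qpoch_inf_nonzero[OF p' p]
    by (simp add: field_simps flip: power_add)
  also have "1 / B * R * \<dots> = qpoch_inf (q ^ 4) (q ^ 4) ^ 4 / qpoch_inf (q ^ 2) (q ^ 2) ^ 2"
    using qpoch_quotient[OF assms] by (simp add: B_def R_def)
  finally show ?thesis
    by (simp only: lambert_base_square[OF assms])
qed

end
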